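(* Let $t\in\mathbb{R}$ and let two combinatorially equivalent triangulations (triangulated surfaces) be given. Consider, for each pair of corresponding triangles, the projective map that maps the triangle to the corresponding triangle (vertices to corresponding vertices) and the exponent-$t$-center to the exponent-$t$-center. If the two triangulations are discretely conformally equivalent, then these projective maps fit together continuously across edges. Moreover, if $t\neq0$, these projective maps fit together continuously across edges only if the triangulations are discretely conformally equivalent.
   Context: For $t\in\mathbb{R}$, the exponent-$t$-center of a triangle $ABC$ is the point with barycentric coordinates $[a^t,b^t,c^t]$, where $a,b,c$ are the lengths of the sides opposite to $A,B,C$, respectively. A triangulated surface here is a surface glued edge-to-edge from Euclidean triangles; $\ell_{ij}$ denotes the length of the edge joining vertices $i$ and $j$. For two combinatorially equivalent triangulated surfaces, $\ell_{ij}$ and $\tilde\ell_{ij}$ denote the lengths of corresponding edges. The two triangulated surfaces are called discretely conformally equivalent if they are combinatorially equivalent and there are real numbers $u_i$ (logarithmic scale factors) associated to the vertices such that $\tilde\ell_{ij}=e^{\frac12(u_i+u_j)}\ell_{ij}$ for all edges $ij$. It is known that this is equivalent to equality of length cross ratios: for every interior edge $ij$ with adjacent triangles $ijk$ and $ijm$, $$\frac{\ell_{im}\ell_{jk}}{\ell_{mj}\ell_{ki}}=\frac{\tilde\ell_{im}\tilde\ell_{jk}}{\tilde\ell_{mj}\tilde\ell_{ki}}.$$ The maps "fit together continuously across edges" if, for every interior edge, the maps on the two adjacent triangles agree on that edge. *)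

theory Defs
  imports "HOL-Analysis.Analysis"
begin

text \<open>A triangle is a map from the three-element type \<open>3\<close> to the plane. Indices of type \<open>3\<close> are
  added modulo 3, so \<open>i + 1\<close> and \<open>i + 2\<close> are the two corners other than \<open>i\<close>.\<close>

definition nondegenerate :: "(3 \<Rightarrow> real^2) \<Rightarrow> bool" where
  "nondegenerate p \<longleftrightarrow> inj p \<and> \<not> affine_dependent (range p)"

definition triangle :: "(3 \<Rightarrow> real^2) \<Rightarrow> (real^2) set" where
  "triangle p = convex hull (range p)"

definition opposite_side :: "(3 \<Rightarrow> real^2) \<Rightarrow> 3 \<Rightarrow> real" where
  "opposite_side p i = dist (p (i + 1)) (p (i + 2))"

definition barycentric_point :: "(3 \<Rightarrow> real^2) \<Rightarrow> (3 \<Rightarrow> real) \<Rightarrow> real^2" where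
  "barycentric_point p w = (\<Sum>i\<in>UNIV. w i *\<^sub>R p i) /\<^sub>R (\<Sum>i\<in>UNIV. w i)"

definition exponent_center :: "real \<Rightarrow> (3 \<Rightarrow> real^2) \<Rightarrow> real^2" where
  "exponent_center t p = barycentric_point p (\<lambda>i. opposite_side p i powr t)"

text \<open>A point \<open>x\<close> of the plane has homogeneous coordinates \<open>(x, 1)\<close>. The condition that the last
  coordinate of the image be nonzero says that no point of \<open>D\<close> is sent to infinity.\<close>

definition projective_on :: "(real^2) set \<Rightarrow> (real^2 \<Rightarrow> real^2) \<Rightarrow> bool" where
  "projective_on D \<phi> \<longleftrightarrow>
     (\<exists>h :: (real^2) \<times> real \<Rightarrow> (real^2) \<times> real. linear h \<and> bij h \<and>
        (\<forall>x\<in>D. snd (h (x, 1)) \<noteq> 0 \<and> \<phi> x = fst (h (x, 1)) /\<^sub>R snd (h (x, 1))))"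

text \<open>The map is regarded as a map on the closed triangle only; being extensional makes it unique
  as a HOL function.\<close>

definition center_projective_map ::
  "real \<Rightarrow> (3 \<Rightarrow> real^2) \<Rightarrow> (3 \<Rightarrow> real^2) \<Rightarrow> real^2 \<Rightarrow> real^2" where
  "center_projective_map t p q =
     (THE \<phi>. \<phi> \<in> extensional (triangle p) \<and> projective_on (triangle p) \<phi> \<and>
        \<phi> ` triangle p = triangle q \<and> (\<forall>i. \<phi> (p i) = q i) \<and>
        \<phi> (exponent_center t p) = exponent_center t q)"

text \<open>Surfaces glued from Euclidean triangles. The triple \<open>(f, i, j)\<close> with \<open>i \<noteq> j\<close> is the side of the
  face \<open>f\<close> directed from corner \<open>i\<close> to corner \<open>j\<close>. A pair \<open>((f, i, j), (g, k, l))\<close> in \<open>glue\<close> means that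
  these sides are identified, \<open>i\<close> with \<open>k\<close> and \<open>j\<close> with \<open>l\<close>. Sides that are not glued form the boundary.
  Two triangles may share several sides or vertices, a triangle may be glued to itself along two
  different sides, and the surface need not be orientable, connected, or compact.\<close>

type_synonym 'f side = "'f \<times> 3 \<times> 3"

record 'f glued_triangles =
  faces :: "'f set"
  glue :: "'f side rel"
  pos :: "'f \<Rightarrow> 3 \<Rightarrow> real^2"

definition sides :: "'f glued_triangles \<Rightarrow> 'f side set" where
  "sides S = {(f, i, j). f \<in> faces S \<and> i \<noteq> j}"

definition len :: "'f glued_triangles \<Rightarrow> 'f side \<Rightarrow> real" where
  "len S = (\<lambda>(f, i, j). dist (pos S f i) (pos S f j))"

text \<open>A vertex of the surface is a class of corners of triangles that are identified by the gluing
  of sides.\<close>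

definition corner_glue :: "'f glued_triangles \<Rightarrow> ('f \<times> 3) rel" where
  "corner_glue S = {((f, i), (g, k)). \<exists>j l. ((f, i, j), (g, k, l)) \<in> glue S}"

definition vertex :: "'f glued_triangles \<Rightarrow> 'f \<times> 3 \<Rightarrow> ('f \<times> 3) set" where
  "vertex S c = (corner_glue S)\<^sup>* `` {c}"

text \<open>Gluing triangles along sides in pairs yields a surface, possibly with boundary, exactly if only
  finitely many corners meet at each vertex, which is the last condition.\<close>

definition triangulated_surface :: "'f glued_triangles \<Rightarrow> bool" where
  "triangulated_surface S \<longleftrightarrow>
     (\<forall>f\<in>faces S. nondegenerate (pos S f)) \<and>
     glue S \<subseteq> sides S \<times> sides S \<and> sym (glue S) \<and> single_valued (glue S) \<and>
     (\<forall>f i j g k l. ((f, i, j), (g, k, l)) \<in> glue S \<longrightarrow>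
        ((f, j, i), (g, l, k)) \<in> glue S \<and>
        (f, {i, j}) \<noteq> (g, {k, l}) \<and>
        len S (f, i, j) = len S (g, k, l)) \<and>
     (\<forall>f\<in>faces S. \<forall>i. finite (vertex S (f, i)))"

text \<open>\<open>\<alpha>\<close> is the correspondence of triangles, \<open>\<pi> f\<close> the correspondence of the corners of \<open>f\<close> with those
  of \<open>\<alpha> f\<close>.\<close>

definition side_map :: "('f \<Rightarrow> 'g) \<Rightarrow> ('f \<Rightarrow> 3 \<Rightarrow> 3) \<Rightarrow> 'f side \<Rightarrow> 'g side" where
  "side_map \<alpha> \<pi> = (\<lambda>(f, i, j). (\<alpha> f, \<pi> f i, \<pi> f j))"

definition combinatorial_equivalence ::
  "'f glued_triangles \<Rightarrow> 'g glued_triangles \<Rightarrow> ('f \<Rightarrow> 'g) \<Rightarrow> ('f \<Rightarrow> 3 \<Rightarrow> 3) \<Rightarrow> bool" where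
  "combinatorial_equivalence S T \<alpha> \<pi> \<longleftrightarrow>
     bij_betw \<alpha> (faces S) (faces T) \<and> (\<forall>f\<in>faces S. bij (\<pi> f)) \<and>
     (\<forall>e\<in>sides S. \<forall>e'\<in>sides S.
        (e, e') \<in> glue S \<longleftrightarrow> (side_map \<alpha> \<pi> e, side_map \<alpha> \<pi> e') \<in> glue T)"

definition discretely_conformally_equivalent ::
  "'f glued_triangles \<Rightarrow> 'g glued_triangles \<Rightarrow> ('f \<Rightarrow> 'g) \<Rightarrow> ('f \<Rightarrow> 3 \<Rightarrow> 3) \<Rightarrow> bool" where
  "discretely_conformally_equivalent S T \<alpha> \<pi> \<longleftrightarrow>
     combinatorial_equivalence S T \<alpha> \<pi> \<and>
     (\<exists>u :: ('f \<times> 3) set \<Rightarrow> real. \<forall>(f, i, j)\<in>sides S.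
        len T (side_map \<alpha> \<pi> (f, i, j)) =
          exp ((u (vertex S (f, i)) + u (vertex S (f, j))) / 2) * len S (f, i, j))"

text \<open>The point \<open>x\<close> of the first side and the point \<open>y\<close> of the second side become the same point when the
  sides are glued.\<close>

definition identified ::
  "'f glued_triangles \<Rightarrow> 'f side \<Rightarrow> 'f side \<Rightarrow> real^2 \<Rightarrow> real^2 \<Rightarrow> bool" where
  "identified S = (\<lambda>(f, i, j) (g, k, l) x y.
     \<exists>s\<in>{0..1}. x = (1 - s) *\<^sub>R pos S f i + s *\<^sub>R pos S f j \<and>
               y = (1 - s) *\<^sub>R pos S g k + s *\<^sub>R pos S g l)"

definition fit_together ::
  "'f glued_triangles \<Rightarrow> 'g glued_triangles \<Rightarrow> ('f \<Rightarrow> 'g) \<Rightarrow> ('f \<Rightarrow> 3 \<Rightarrow> 3) \<Rightarrow>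
     ('f \<Rightarrow> real^2 \<Rightarrow> real^2) \<Rightarrow> bool" where
  "fit_together S T \<alpha> \<pi> \<Phi> \<longleftrightarrow>
     (\<forall>(e, e')\<in>glue S. \<forall>x y. identified S e e' x y \<longrightarrow>
        identified T (side_map \<alpha> \<pi> e) (side_map \<alpha> \<pi> e') (\<Phi> (fst e) x) (\<Phi> (fst e') y))"

definition center_maps ::
  "real \<Rightarrow> 'f glued_triangles \<Rightarrow> 'g glued_triangles \<Rightarrow> ('f \<Rightarrow> 'g) \<Rightarrow> ('f \<Rightarrow> 3 \<Rightarrow> 3) \<Rightarrow>
     'f \<Rightarrow> real^2 \<Rightarrow> real^2" where
  "center_maps t S T \<alpha> \<pi> f = center_projective_map t (pos S f) (\<lambda>i. pos T (\<alpha> f) (\<pi> f i))"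

end

theory Submission
  imports Defs
begin

text \<open>
  Barycentric coordinates are homogeneous coordinates, so a projective map that sends the corners
  of one triangle to those of another acts on barycentric coordinates by a diagonal matrix
  \<open>[x\<^sub>i] \<mapsto> [r\<^sub>i x\<^sub>i]\<close>. Prescribing the image of one further point with positive coordinates
  determines the diagonal up to a common factor. For the exponent-\<open>t\<close>-centers it is
  \<open>r\<^sub>i = (a'\<^sub>i / a\<^sub>i)\<^sup>t\<close>, where \<open>a\<^sub>i\<close> and \<open>a'\<^sub>i\<close> are the lengths of the sides opposite to corner \<open>i\<close> in
  the two triangles (\<open>center_projective_map_barycentric\<close>).

  On the side \<open>ij\<close> of a triangle \<open>ijm\<close> such a map depends only on the ratio \<open>r\<^sub>j / r\<^sub>i\<close>. With the
  logarithmic length factors \<open>\<lambda>\<^sub>i\<^sub>j = ln (l'\<^sub>i\<^sub>j / l\<^sub>i\<^sub>j)\<close> this ratio is \<open>exp (t (\<lambda>\<^sub>i\<^sub>m - \<lambda>\<^sub>j\<^sub>m))\<close>. So the maps fit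
  together if and only if \<open>t (\<lambda>\<^sub>i\<^sub>m - \<lambda>\<^sub>j\<^sub>m)\<close> is the same for the two triangles at each interior edge
  (\<open>fit_together_iff\<close>); for \<open>t \<noteq> 0\<close> this is the equality of length cross ratios.

  If \<open>\<lambda>\<^sub>i\<^sub>j = (u\<^sub>i + u\<^sub>j) / 2\<close>, then \<open>\<lambda>\<^sub>i\<^sub>m - \<lambda>\<^sub>j\<^sub>m = (u\<^sub>i - u\<^sub>j) / 2\<close> depends only on the ends of the edge, and
  the maps fit together. Conversely, in a single triangle the three equations
  \<open>2 \<lambda>\<^sub>i\<^sub>j = u\<^sub>i + u\<^sub>j\<close> have the unique solution \<open>u\<^sub>i = \<lambda>\<^sub>i\<^sub>j + \<lambda>\<^sub>i\<^sub>m - \<lambda>\<^sub>j\<^sub>m\<close>. Since \<open>\<lambda>\<^sub>i\<^sub>j\<close> agrees in the two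
  triangles at the edge \<open>ij\<close>, equality of \<open>\<lambda>\<^sub>i\<^sub>m - \<lambda>\<^sub>j\<^sub>m\<close> says exactly that the solutions at glued corners
  agree, so that they define scale factors at the vertices of the surface.
\<close>

section \<open>Corners and sides of a triangle\<close>

lemma third_corner:
  fixes i j :: 3
  assumes "i \<noteq> j"
  obtains k where "k \<noteq> i" "k \<noteq> j" "UNIV = {i, j, k}"
proof -
  have "card (UNIV - {i, j}) = 1"
    using assms by (simp add: card_Diff_subset)
  then obtain k where "UNIV - {i, j} = {k}" by (rule card_1_singletonE)
  thus ?thesis using that[of k] by blast
qed

lemma cyclic_corners:
  fixes i j k :: 3
  assumes "i \<noteq> j" "j \<noteq> k" "k \<noteq> i"
  shows "i + 1 = j \<and> i + 2 = k \<or> i + 1 = k \<and> i + 2 = j"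
  using assms exhaust_3[of i] exhaust_3[of j] exhaust_3[of k] by (elim disjE) auto

lemma opposite_side_eq_dist:
  assumes "i \<noteq> j" "j \<noteq> k" "k \<noteq> i"
  shows "opposite_side p i = dist (p j) (p k)"
  using cyclic_corners[OF assms] by (auto simp: opposite_side_def dist_commute)

lemma opposite_side_pos:
  assumes "nondegenerate p"
  shows "opposite_side p i > 0"
proof -
  have "p (i + 1) \<noteq> p (i + 2)"
    using assms by (simp add: nondegenerate_def inj_eq)
  thus ?thesis by (simp add: opposite_side_def)
qed

section \<open>Homogeneous and barycentric coordinates\<close>

text \<open>
  The weights range over \<open>real^3\<close> and not over functions on \<open>3\<close>, because only the former is a Euclidean
  space, where dimension arguments are available.
\<close>

definition homogeneous :: "(3 \<Rightarrow> real^2) \<Rightarrow> real^3 \<Rightarrow> (real^2) \<times> real" where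
  "homogeneous p a = (\<Sum>i\<in>UNIV. a $ i *\<^sub>R (p i, 1))"

lemma fst_homogeneous: "fst (homogeneous p a) = (\<Sum>i\<in>UNIV. a $ i *\<^sub>R p i)"
  and snd_homogeneous: "snd (homogeneous p a) = (\<Sum>i\<in>UNIV. a $ i)"
  by (simp_all add: homogeneous_def fst_sum snd_sum)

lemma linear_homogeneous: "linear (homogeneous p)"
  unfolding homogeneous_def
  by (intro linear_compose_sum ballI linear_compose_scale_right linearI)
    (simp_all add: scaleR_left_distrib)

text \<open>
  Affine independence of the corners is linear independence of the three vectors \<open>(p i, 1)\<close> in the
  three-dimensional space \<open>real^2 \<times> real\<close>, so they form a basis.
\<close>

lemma bij_homogeneous:
  assumes "nondegenerate p"
  shows "bij (homogeneous p)"
proof -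
  have inj_p: "inj p" and indep: "\<not> affine_dependent (range p)"
    using assms by (auto simp: nondegenerate_def)
  have "a = 0" if "homogeneous p a = 0" for a
  proof -
    define U where "U = (\<lambda>x. a $ (inv p x))"
    have U: "U (p i) = a $ i" for i
      using inj_p by (simp add: U_def)
    have "sum U (range p) = 0"
      using that inj_p snd_homogeneous[of p a] by (simp add: sum.reindex U)
    moreover have "(\<Sum>x\<in>range p. U x *\<^sub>R x) = 0"
      using that inj_p fst_homogeneous[of p a] by (simp add: sum.reindex U)
    ultimately have "\<forall>x\<in>range p. U x = 0"
      using indep by (subst (asm) affine_dependent_explicit_finite) auto
    thus ?thesis by (auto simp: U vec_eq_iff)
  qed
  hence inj: "inj (homogeneous p)"
    using linear_homogeneous by (simp add: linear_injective_0)
  have "dim (range (homogeneous p)) = dim (UNIV :: (real^3) set)"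
    using linear_homogeneous inj by (intro dim_image_eq) (auto intro: inj_on_subset)
  hence "span (range (homogeneous p)) = UNIV"
    by (simp flip: dim_eq_full)
  moreover have "span (range (homogeneous p)) = range (homogeneous p)"
    using linear_homogeneous by (metis span_eq_iff subspace_UNIV linear_subspace_image)
  ultimately show ?thesis
    using inj by (simp add: bij_def)
qed

lemma barycentric_point_homogeneous:
  "barycentric_point p w = fst (homogeneous p (\<chi> i. w i)) /\<^sub>R snd (homogeneous p (\<chi> i. w i))"
  by (simp add: barycentric_point_def fst_homogeneous snd_homogeneous)

lemma homogeneous_barycentric_point:
  assumes "(\<Sum>i\<in>UNIV. w i) \<noteq> 0"
  shows "(barycentric_point p w, 1) = homogeneous p (\<chi> i. w i) /\<^sub>R (\<Sum>i\<in>UNIV. w i)"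
  using assms
  by (simp add: prod_eq_iff barycentric_point_homogeneous snd_homogeneous)

lemma barycentric_point_scale:
  assumes "c \<noteq> 0"
  shows "barycentric_point p (\<lambda>i. c * w i) = barycentric_point p w"
proof -
  have "(\<Sum>i\<in>UNIV. (c * w i) *\<^sub>R p i) = c *\<^sub>R (\<Sum>i\<in>UNIV. w i *\<^sub>R p i)"
    by (simp add: scaleR_right.sum)
  thus ?thesis
    using assms by (simp add: barycentric_point_def flip: sum_distrib_left)
qed

lemma triangle_eq:
  assumes "inj p"
  shows "triangle p = {barycentric_point p w |w. (\<forall>i. w i \<ge> 0) \<and> (\<Sum>i\<in>UNIV. w i) > 0}"
    (is "_ = ?R")
proof (intro equalityI subsetI)
  fix x assume "x \<in> triangle p"
  then obtain u where u: "\<forall>y\<in>range p. 0 \<le> u y" "sum u (range p) = 1"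
    "(\<Sum>y\<in>range p. u y *\<^sub>R y) = x"
    by (auto simp: triangle_def convex_hull_finite)
  have "x = barycentric_point p (u \<circ> p)" "sum (u \<circ> p) UNIV = 1"
    using u(2,3) assms by (auto simp: barycentric_point_def sum.reindex)
  thus "x \<in> ?R" using u(1) by (intro CollectI exI[of _ "u \<circ> p"]) auto
next
  fix x assume "x \<in> ?R"
  then obtain w where w: "\<forall>i. w i \<ge> 0" "(\<Sum>i\<in>UNIV. w i) > 0" "x = barycentric_point p w"
    by blast
  define W where "W = (\<Sum>i\<in>UNIV. w i)"
  have "x = (\<Sum>i\<in>UNIV. (w i / W) *\<^sub>R p i)"
    using w by (simp add: barycentric_point_def W_def scaleR_right.sum divide_inverse mult.commute)
  also have "\<dots> \<in> convex hull (range p)"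
    using w by (intro convex_sum)
      (auto simp: W_def hull_inc convex_convex_hull simp flip: sum_divide_distrib)
  finally show "x \<in> triangle p" by (simp add: triangle_def)
qed

lemma barycentric_point_corner: "barycentric_point p (\<lambda>k. if k = i then 1 else 0) = p i"
  by (simp add: barycentric_point_def if_distrib[of "\<lambda>c. c *\<^sub>R _"] cong: if_cong)

lemma corner_in_triangle: "p i \<in> triangle p"
  by (simp add: triangle_def hull_inc)

section \<open>Projective maps between triangles\<close>

text \<open>
  In the bases \<open>(p i, 1)\<close> and \<open>(q i, 1)\<close> the linear map behind \<open>\<phi>\<close> is diagonal, because \<open>\<phi>\<close> sends corners
  to corners. The image of the fourth point forces the diagonal entries to be proportional to
  \<open>w i / v i\<close>, and a common factor does not change a point.
\<close>

lemma projective_map_barycentric: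
  assumes p: "nondegenerate p" and q: "nondegenerate q"
    and \<phi>: "projective_on (triangle p) \<phi>" "\<And>i. \<phi> (p i) = q i"
      "\<phi> (barycentric_point p v) = barycentric_point q w"
    and v: "\<And>i. v i > 0" and w: "\<And>i. w i > 0"
    and a: "\<And>i. a i \<ge> 0" "(\<Sum>i\<in>UNIV. a i) > 0"
  shows "\<phi> (barycentric_point p a) = barycentric_point q (\<lambda>i. a i * (w i / v i))"
proof -
  have inj: "inj p" using p by (simp add: nondegenerate_def)
  obtain h :: "(real^2) \<times> real \<Rightarrow> (real^2) \<times> real" where h: "linear h"
    "\<And>x. x \<in> triangle p \<Longrightarrow> snd (h (x, 1)) \<noteq> 0"
    "\<And>x. x \<in> triangle p \<Longrightarrow> \<phi> x = fst (h (x, 1)) /\<^sub>R snd (h (x, 1))"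
    using \<phi>(1) unfolding projective_on_def by blast
  have h_eq: "h (x, 1) = snd (h (x, 1)) *\<^sub>R (\<phi> x, 1)" if "x \<in> triangle p" for x
    using h(2,3)[OF that] by (simp add: prod_eq_iff)
  \<comment> \<open>The diagonal entries of \<open>h\<close>.\<close>
  define c where "c i = snd (h (p i, 1))" for i
  have c: "h (p i, 1) = c i *\<^sub>R (q i, 1)" for i
    using h_eq[OF corner_in_triangle] \<phi>(2) unfolding c_def by metis
  have h_hom: "h (homogeneous p b) = homogeneous q (\<chi> i. c i * b $ i)" for b
    unfolding homogeneous_def linear_sum[OF h(1)]
    by (simp only: linear_cmul[OF h(1)] c scaleR_scaleR vec_lambda_beta mult.commute)
  define V where "V = (\<Sum>i\<in>UNIV. v i)"
  define W where "W = (\<Sum>i\<in>UNIV. w i)"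
  have V: "V > 0" and W: "W > 0"
    unfolding V_def W_def using v w by (auto intro!: sum_pos)
  define z where "z = barycentric_point p v"
  define d where "d = snd (h (z, 1))"
  have z: "z \<in> triangle p"
    using v V by (auto simp: triangle_eq[OF inj] z_def V_def intro: less_imp_le)
  have "homogeneous q (\<chi> i. c i * v i) = V *\<^sub>R h (z, 1)"
    using V h_hom[of "\<chi> i. v i"]
    by (simp add: z_def homogeneous_barycentric_point V_def[symmetric] linear_cmul[OF h(1)])
  also have "\<dots> = V *\<^sub>R d *\<^sub>R (barycentric_point q w, 1)"
    using h_eq[OF z] \<phi>(3) by (simp add: d_def z_def)
  also have "\<dots> = homogeneous q ((V * d / W) *\<^sub>R (\<chi> i. w i))"
    using W by (simp add: homogeneous_barycentric_point W_def[symmetric]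
        linear_cmul[OF linear_homogeneous] divide_inverse)
  \<comment> \<open>Both sides are coordinates of the image of the fourth point, which are unique.\<close>
  finally have "(\<chi> i. c i * v i) = (V * d / W) *\<^sub>R (\<chi> i. w i)"
    using bij_homogeneous[OF q] by (simp add: bij_def inj_eq)
  hence c_eq: "c i = (V * d / W) * (w i / v i)" for i
    using v[of i] W by (simp add: vec_eq_iff eq_divide_eq mult_ac)
  define \<kappa> where "\<kappa> = V * d / W"
  have "\<kappa> \<noteq> 0" using V W h(2)[OF z] by (simp add: \<kappa>_def d_def)
  define A where "A = (\<Sum>i\<in>UNIV. a i)"
  have A: "A > 0" using a by (simp add: A_def)
  have "h (barycentric_point p a, 1) = homogeneous q (\<chi> i. c i * a i) /\<^sub>R A"
    using A h_hom[of "\<chi> i. a i"]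
    by (simp add: homogeneous_barycentric_point A_def[symmetric] linear_cmul[OF h(1)])
  moreover have "barycentric_point p a \<in> triangle p"
    using a by (auto simp: triangle_eq[OF inj])
  ultimately have "\<phi> (barycentric_point p a) = barycentric_point q (\<lambda>i. c i * a i)"
    using A h(3) by (simp add: barycentric_point_homogeneous)
  also have "(\<lambda>i. c i * a i) = (\<lambda>i. \<kappa> * (a i * (w i / v i)))"
    by (simp add: c_eq \<kappa>_def mult_ac)
  also have "barycentric_point q \<dots> = barycentric_point q (\<lambda>i. a i * (w i / v i))"
    using \<open>\<kappa> \<noteq> 0\<close> by (rule barycentric_point_scale)
  finally show ?thesis .
qed

lemma sum_rescaled_pos:
  fixes a r :: "'a::finite \<Rightarrow> real"
  assumes "\<And>i. a i \<ge> 0" "(\<Sum>i\<in>UNIV. a i) > 0" "\<And>i. r i > 0"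
  shows "(\<Sum>i\<in>UNIV. a i * r i) > 0"
proof -
  obtain i where "a i \<noteq> 0" using assms(2) by (metis less_irrefl sum.neutral)
  hence "a i * r i > 0" using assms(1)[of i] assms(3)[of i] by simp
  thus ?thesis using assms by (intro sum_pos2[of _ i]) (auto intro!: mult_nonneg_nonneg less_imp_le[OF assms(3)])
qed

lemma linear_inv_bij:
  assumes "linear f" "bij f"
  shows "linear (inv f)"
proof (rule linearI)
  have f: "f (inv f x) = x" "inv f (f z) = z" for x z
    using assms(2) by (auto simp: bij_is_surj surj_f_inv_f bij_is_inj)
  show "inv f (x + y) = inv f x + inv f y" for x y
    by (metis f linear_add[OF assms(1)])
  show "inv f (c *\<^sub>R x) = c *\<^sub>R inv f x" for c x
    by (metis f linear_cmul[OF assms(1)])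
qed

text \<open>
  The map is given in homogeneous coordinates by the diagonal matrix with entries \<open>r i\<close>. Positivity of
  the entries keeps the sum of the coordinates positive on the triangle, so no point of the triangle
  goes to infinity, and it makes the map with the inverse entries send the target back onto the source.
\<close>

lemma exists_projective_map:
  assumes p: "nondegenerate p" and q: "nondegenerate q" and r: "\<And>i. r i > 0"
  obtains \<phi> where "\<phi> \<in> extensional (triangle p)" "projective_on (triangle p) \<phi>"
    "\<phi> ` triangle p = triangle q" "\<And>i. \<phi> (p i) = q i"
    "\<And>a. (\<And>i. a i \<ge> 0) \<Longrightarrow> (\<Sum>i\<in>UNIV. a i) > 0 \<Longrightarrow>
       \<phi> (barycentric_point p a) = barycentric_point q (\<lambda>i. a i * r i)"
proof -
  have injp: "inj p" and injq: "inj q" using p q by (auto simp: nondegenerate_def)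
  define D :: "real^3 \<Rightarrow> real^3" where "D a = (\<chi> i. a $ i * r i)" for a
  have "linear D"
    by (rule linearI) (auto simp: D_def vec_eq_iff algebra_simps)
  moreover have "bij D"
  proof (rule bij_betw_byWitness[where f' = "\<lambda>a. \<chi> i. a $ i / r i"])
    have "r i \<noteq> 0" for i using r[of i] by simp
    thus "\<forall>a\<in>UNIV. (\<chi> i. D a $ i / r i) = a" "\<forall>a\<in>UNIV. D (\<chi> i. a $ i / r i) = a"
      by (auto simp: D_def vec_eq_iff)
  qed auto
  moreover note bp = bij_homogeneous[OF p]
  ultimately have lin: "linear (homogeneous q \<circ> D \<circ> inv (homogeneous p))"
    and bij: "bij (homogeneous q \<circ> D \<circ> inv (homogeneous p))"
    using bij_homogeneous[OF q] linear_homogeneous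
    by (auto intro!: linear_compose bij_comp bij_imp_bij_inv linear_inv_bij)
  define h where "h = homogeneous q \<circ> D \<circ> inv (homogeneous p)"
  define \<phi> where "\<phi> = restrict (\<lambda>x. fst (h (x, 1)) /\<^sub>R snd (h (x, 1))) (triangle p)"
  have h: "h (barycentric_point p a, 1) = homogeneous q (\<chi> i. a i * r i) /\<^sub>R (\<Sum>i\<in>UNIV. a i)"
    if "(\<Sum>i\<in>UNIV. a i) > 0" for a
  proof -
    have "h (homogeneous p b) = homogeneous q (D b)" for b
      using bp by (simp add: h_def bij_is_inj)
    thus ?thesis
      using that lin by (simp add: homogeneous_barycentric_point linear_cmul h_def[symmetric] D_def)
  qed
  have \<phi>: "\<phi> (barycentric_point p a) = barycentric_point q (\<lambda>i. a i * r i)"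
    if "\<And>i. a i \<ge> 0" "(\<Sum>i\<in>UNIV. a i) > 0" for a
  proof -
    have "barycentric_point p a \<in> triangle p"
      using that by (auto simp: triangle_eq[OF injp])
    thus ?thesis
      using that h[OF that(2)] by (simp add: \<phi>_def barycentric_point_homogeneous)
  qed
  show ?thesis
  proof (rule that[of \<phi>])
    have "snd (h (x, 1)) \<noteq> 0" if x: "x \<in> triangle p" for x
    proof -
      obtain a where a: "\<forall>i. a i \<ge> 0" "(\<Sum>i\<in>UNIV. a i) > 0" "x = barycentric_point p a"
        using x by (auto simp: triangle_eq[OF injp])
      thus ?thesis
        using sum_rescaled_pos[of a r] r by (auto simp: h snd_homogeneous)
    qed
    thus "projective_on (triangle p) \<phi>"
      using lin bij unfolding projective_on_def h_def[symmetric]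
      by (intro exI[of _ h]) (auto simp: \<phi>_def)
    show "\<phi> ` triangle p = triangle q"
    proof (intro equalityI subsetI)
      fix y assume "y \<in> \<phi> ` triangle p"
      then obtain a where a: "\<forall>i. a i \<ge> 0" "(\<Sum>i\<in>UNIV. a i) > 0" "y = \<phi> (barycentric_point p a)"
        by (auto simp: triangle_eq[OF injp])
      thus "y \<in> triangle q"
        using sum_rescaled_pos[of a r] r
        by (auto simp: \<phi> triangle_eq[OF injq] intro!: exI[of _ "\<lambda>i. a i * r i"] mult_nonneg_nonneg less_imp_le[OF r])
    next
      fix y assume "y \<in> triangle q"
      then obtain b where b: "\<forall>i. b i \<ge> 0" "(\<Sum>i\<in>UNIV. b i) > 0" "y = barycentric_point q b"
        by (auto simp: triangle_eq[OF injq])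
      define a where "a i = b i * (1 / r i)" for i
      have "\<And>i. a i \<ge> 0" using b r by (auto simp: a_def less_imp_le)
      moreover have "(\<Sum>i\<in>UNIV. a i) > 0"
        unfolding a_def using b r by (intro sum_rescaled_pos) auto
      moreover have "a i * r i = b i" for i using r[of i] by (simp add: a_def)
      ultimately have "y = \<phi> (barycentric_point p a)" "barycentric_point p a \<in> triangle p"
        using b by (auto simp: \<phi> triangle_eq[OF injp])
      thus "y \<in> \<phi> ` triangle p" by blast
    qed
    show "\<phi> (p i) = q i" for i
    proof -
      have "\<phi> (p i) = barycentric_point q (\<lambda>k. (if k = i then 1 else 0) * r k)"
        using \<phi>[of "\<lambda>k. if k = i then 1 else 0"] by (simp add: barycentric_point_corner)
      also have "(\<lambda>k. (if k = i then 1 else 0) * r k) = (\<lambda>k. r i * (if k = i then 1 else 0))"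
        by auto
      finally have "\<phi> (p i) = barycentric_point q (\<lambda>k. r i * (if k = i then 1 else 0))" .
      thus ?thesis
        using r[of i] by (simp add: barycentric_point_scale barycentric_point_corner)
    qed
  qed (use \<phi> in \<open>auto simp: \<phi>_def\<close>)
qed

text \<open>
  By \<open>projective_map_barycentric\<close> the conditions that characterize the map determine its values, and
  \<open>exists_projective_map\<close> shows that they can be met, so the definite description denotes that map.
\<close>

lemma center_projective_map_barycentric:
  assumes p: "nondegenerate p" and q: "nondegenerate q"
    and a: "\<And>i. a i \<ge> 0" "(\<Sum>i\<in>UNIV. a i) > 0"
  shows "center_projective_map t p q (barycentric_point p a) =
    barycentric_point q (\<lambda>i. a i * (opposite_side q i / opposite_side p i) powr t)"
proof -
  have inj: "inj p" using p by (simp add: nondegenerate_def)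
  define v where "v = (\<lambda>i. opposite_side p i powr t)"
  define w where "w = (\<lambda>i. opposite_side q i powr t)"
  have v: "v i > 0" and w: "w i > 0" for i
    using opposite_side_pos[OF p, of i] opposite_side_pos[OF q, of i] by (auto simp: v_def w_def)
  have center: "exponent_center t p = barycentric_point p v"
    "exponent_center t q = barycentric_point q w"
    by (auto simp: exponent_center_def v_def w_def)
  define P where "P \<phi> \<longleftrightarrow> \<phi> \<in> extensional (triangle p) \<and> projective_on (triangle p) \<phi> \<and>
        \<phi> ` triangle p = triangle q \<and> (\<forall>i. \<phi> (p i) = q i) \<and>
        \<phi> (exponent_center t p) = exponent_center t q" for \<phi>
  have val: "\<phi> (barycentric_point p b) = barycentric_point q (\<lambda>i. b i * (w i / v i))"
    if "P \<phi>" "\<And>i. b i \<ge> 0" "(\<Sum>i\<in>UNIV. b i) > 0" for \<phi> b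
    using that v w by (intro projective_map_barycentric[OF p q]) (auto simp: P_def center)
  have "\<exists>!\<phi>. P \<phi>"
  proof (rule ex_ex1I)
    obtain \<phi> where \<phi>: "\<phi> \<in> extensional (triangle p)" "projective_on (triangle p) \<phi>"
      "\<phi> ` triangle p = triangle q" "\<And>i. \<phi> (p i) = q i"
      "\<And>a. (\<And>i. a i \<ge> 0) \<Longrightarrow> (\<Sum>i\<in>UNIV. a i) > 0 \<Longrightarrow>
         \<phi> (barycentric_point p a) = barycentric_point q (\<lambda>i. a i * (w i / v i))"
      by (rule exists_projective_map[OF p q, of "\<lambda>i. w i / v i"]) (use v w in auto)
    have "v i * (w i / v i) = w i" for i using v[of i] by simp
    hence "\<phi> (barycentric_point p v) = barycentric_point q w"
      using \<phi>(5)[of v] v by (simp add: less_imp_le sum_pos)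
    thus "\<exists>\<phi>. P \<phi>" using \<phi> by (auto simp: P_def center)
  next
    fix \<phi> \<psi> assume *: "P \<phi>" "P \<psi>"
    show "\<phi> = \<psi>"
    proof (rule extensionalityI[of _ "triangle p"])
      fix x assume "x \<in> triangle p"
      thus "\<phi> x = \<psi> x"
        using val[OF *(1)] val[OF *(2)] by (auto simp: triangle_eq[OF inj])
    qed (use * in \<open>auto simp: P_def\<close>)
  qed
  hence "P (center_projective_map t p q)"
    unfolding center_projective_map_def P_def by (rule theI')
  from val[OF this a] show ?thesis
    using opposite_side_pos[OF p] opposite_side_pos[OF q]
    by (simp add: v_def w_def powr_divide less_imp_le)
qed

section \<open>Restriction to an edge\<close>

lemma barycentric_point_edge:
  assumes "i \<noteq> j" "a + b \<noteq> 0"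
  shows "barycentric_point p (\<lambda>m. if m = i then a else if m = j then b else 0) =
    (1 - b / (a + b)) *\<^sub>R p i + (b / (a + b)) *\<^sub>R p j"
proof -
  obtain k where k: "k \<noteq> i" "k \<noteq> j" "UNIV = {i, j, k}"
    using third_corner[OF assms(1)] .
  have "1 - b / (a + b) = a / (a + b)" using assms(2) by (simp add: field_simps)
  thus ?thesis
    using assms k(1,2) unfolding barycentric_point_def k(3)
    by (auto simp: scaleR_right_distrib divide_inverse mult.commute)
qed

text \<open>
  The projective self-map of the unit interval that fixes both ends and has ratio \<open>\<rho>\<close> of the diagonal
  entries: \<open>[1 - s, s] \<mapsto> [1 - s, \<rho> s]\<close>.
\<close>

definition edge_param :: "real \<Rightarrow> real \<Rightarrow> real" where
  "edge_param \<rho> s = s * \<rho> / ((1 - s) + s * \<rho>)"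

lemma edge_param_in_unit:
  assumes "\<rho> > 0" "s \<in> {0..1}"
  shows "edge_param \<rho> s \<in> {0..1}"
proof -
  have "(1 - s) + s * \<rho> > 0"
    using assms by (cases "s = 0") (auto intro!: add_nonneg_pos)
  thus ?thesis using assms by (auto simp: edge_param_def)
qed

text \<open>
  A one-dimensional projective map with fixed ends is determined by the image of the midpoint, so a
  comparison at midpoints suffices to compare the ratios of two triangles.
\<close>

lemma edge_param_half_inj:
  assumes "\<rho> > 0" "\<rho>' > 0" "edge_param \<rho> (1/2) = edge_param \<rho>' (1/2)"
  shows "\<rho> = \<rho>'"
  using assms by (simp add: edge_param_def field_simps)

lemma center_projective_map_edge:
  fixes s t :: real
  assumes p: "nondegenerate p" and q: "nondegenerate q"
    and ij: "i \<noteq> j" and s: "s \<in> {0..1}"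
  defines "\<rho> \<equiv> (opposite_side q j / opposite_side p j) powr t /
     (opposite_side q i / opposite_side p i) powr t"
  shows "center_projective_map t p q ((1 - s) *\<^sub>R p i + s *\<^sub>R p j) =
    (1 - edge_param \<rho> s) *\<^sub>R q i + edge_param \<rho> s *\<^sub>R q j"
proof -
  define r where "r m = (opposite_side q m / opposite_side p m) powr t" for m
  have r: "r m > 0" for m
    using opposite_side_pos[OF p, of m] opposite_side_pos[OF q, of m] by (simp add: r_def)
  define a where "a m = (if m = i then 1 - s else if m = j then s else 0)" for m
  have "sum a UNIV = 1"
  proof -
    obtain k where k: "k \<noteq> i" "k \<noteq> j" "UNIV = {i, j, k}"
      using third_corner[OF ij] .
    show ?thesis using ij k(1,2) unfolding k(3) by (auto simp: a_def)
  qed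
  have pos: "(1 - s) * r i + s * r j > 0"
    using s r[of i] r[of j] by (cases "s = 0") (auto intro!: add_nonneg_pos)
  have "(1 - s) *\<^sub>R p i + s *\<^sub>R p j = barycentric_point p a"
    using barycentric_point_edge[OF ij, of "1 - s" s p] by (simp add: a_def[abs_def])
  also have "center_projective_map t p q \<dots> = barycentric_point q (\<lambda>m. a m * r m)"
    unfolding r_def using s \<open>sum a UNIV = 1\<close>
    by (intro center_projective_map_barycentric[OF p q]) (auto simp: a_def)
  also have "(\<lambda>m. a m * r m) = (\<lambda>m. if m = i then (1 - s) * r i else if m = j then s * r j else 0)"
    by (auto simp: a_def)
  also have "barycentric_point q \<dots> =
    (1 - s * r j / ((1 - s) * r i + s * r j)) *\<^sub>R q i + (s * r j / ((1 - s) * r i + s * r j)) *\<^sub>R q j"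
    using pos by (intro barycentric_point_edge[OF ij]) simp
  also have "s * r j / ((1 - s) * r i + s * r j) = edge_param \<rho> s"
  proof -
    have "\<rho> = r j / r i" by (simp add: \<rho>_def r_def)
    moreover have "(1 - s) + s * (r j / r i) = ((1 - s) * r i + s * r j) / r i"
      using r[of i] by (simp add: field_simps)
    ultimately show ?thesis using r[of i] by (simp add: edge_param_def)
  qed
  finally show ?thesis .
qed

section \<open>The fitting condition on a surface\<close>

lemma vertex_eq_if_corner_glue:
  assumes "sym (glue S)" "(c, d) \<in> corner_glue S"
  shows "vertex S c = vertex S d"
proof -
  have "(d, c) \<in> corner_glue S"
    using assms by (auto simp: corner_glue_def dest: symD)
  thus ?thesis
    using assms(2) by (auto simp: vertex_def intro: converse_rtrancl_into_rtrancl)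
qed

locale surface_pair =
  fixes S :: "'f glued_triangles" and T :: "'g glued_triangles"
    and \<alpha> :: "'f \<Rightarrow> 'g" and \<pi> :: "'f \<Rightarrow> 3 \<Rightarrow> 3"
  assumes surface_S: "triangulated_surface S" and surface_T: "triangulated_surface T"
    and equiv: "combinatorial_equivalence S T \<alpha> \<pi>"
begin

definition log_scale :: "'f \<Rightarrow> 3 \<Rightarrow> 3 \<Rightarrow> real" where
  "log_scale f i j = ln (len T (side_map \<alpha> \<pi> (f, i, j)) / len S (f, i, j))"

text \<open>
  The corresponding triangle of the second surface, with its corners labelled as those of the first.
\<close>

definition target :: "'f \<Rightarrow> 3 \<Rightarrow> real^2" where
  "target f i = pos T (\<alpha> f) (\<pi> f i)"

lemma nondegenerate_pos: "f \<in> faces S \<Longrightarrow> nondegenerate (pos S f)"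
  using surface_S by (simp add: triangulated_surface_def)

lemma nondegenerate_target:
  assumes "f \<in> faces S"
  shows "nondegenerate (target f)"
proof -
  have "bij (\<pi> f)" "\<alpha> f \<in> faces T"
    using assms equiv by (auto simp: combinatorial_equivalence_def bij_betw_def)
  moreover from this have "nondegenerate (pos T (\<alpha> f))"
    using surface_T by (simp add: triangulated_surface_def)
  moreover have target: "target f = pos T (\<alpha> f) \<circ> \<pi> f" by (simp add: fun_eq_iff target_def)
  moreover have "range (target f) = range (pos T (\<alpha> f))"
    using bij_is_surj[OF \<open>bij (\<pi> f)\<close>] by (simp only: target image_comp[symmetric])
  ultimately show ?thesis
    by (simp add: nondegenerate_def bij_is_inj inj_compose)
qed

lemma glueD:
  assumes "((f, i, j), (g, k, l)) \<in> glue S"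
  shows "f \<in> faces S" "g \<in> faces S" "i \<noteq> j" "k \<noteq> l" "((f, j, i), (g, l, k)) \<in> glue S"
    "vertex S (f, i) = vertex S (g, k)"
  using assms surface_S vertex_eq_if_corner_glue[of S "(f, i)" "(g, k)"]
  by (fastforce simp: triangulated_surface_def sides_def corner_glue_def)+

lemma len_pos:
  assumes "f \<in> faces S" "i \<noteq> j"
  shows "len S (f, i, j) > 0" "len T (side_map \<alpha> \<pi> (f, i, j)) > 0"
  using nondegenerate_pos[OF assms(1)] nondegenerate_target[OF assms(1)] assms(2)
  by (auto simp: len_def side_map_def nondegenerate_def target_def[symmetric] inj_eq)

lemma log_scale_commute: "log_scale f i j = log_scale f j i"
  by (simp add: log_scale_def len_def side_map_def dist_commute)

lemma log_scale_glue:
  assumes "((f, i, j), (g, k, l)) \<in> glue S"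
  shows "log_scale f i j = log_scale g k l"
proof -
  have "(f, i, j) \<in> sides S" "(g, k, l) \<in> sides S"
    using glueD[OF assms] by (auto simp: sides_def)
  hence "(side_map \<alpha> \<pi> (f, i, j), side_map \<alpha> \<pi> (g, k, l)) \<in> glue T"
    using assms equiv by (auto simp: combinatorial_equivalence_def)
  hence "len T (side_map \<alpha> \<pi> (f, i, j)) = len T (side_map \<alpha> \<pi> (g, k, l))"
    using surface_T by (simp add: triangulated_surface_def side_map_def)
  moreover have "len S (f, i, j) = len S (g, k, l)"
    using assms surface_S by (simp add: triangulated_surface_def)
  ultimately show ?thesis by (simp add: log_scale_def)
qed

lemma opposite_side_ratio:
  assumes "f \<in> faces S" "i \<noteq> j" "j \<noteq> k" "k \<noteq> i"
  shows "(opposite_side (target f) i / opposite_side (pos S f) i) powr t = exp (t * log_scale f j k)"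
  using len_pos[OF assms(1,3)] opposite_side_eq_dist[OF assms(2-4)]
  by (simp add: powr_def log_scale_def len_def side_map_def target_def)

lemma center_maps_edge:
  fixes s t :: real
  assumes "f \<in> faces S" "i \<noteq> j" "j \<noteq> m" "m \<noteq> i" "s \<in> {0..1}"
  defines "\<rho> \<equiv> exp (t * (log_scale f i m - log_scale f j m))"
  shows "center_maps t S T \<alpha> \<pi> f ((1 - s) *\<^sub>R pos S f i + s *\<^sub>R pos S f j) =
    (1 - edge_param \<rho> s) *\<^sub>R target f i + edge_param \<rho> s *\<^sub>R target f j"
proof -
  have "center_maps t S T \<alpha> \<pi> f = center_projective_map t (pos S f) (target f)"
    by (simp add: center_maps_def target_def[abs_def])
  moreover have "\<rho> = (opposite_side (target f) j / opposite_side (pos S f) j) powr t /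
     (opposite_side (target f) i / opposite_side (pos S f) i) powr t"
    using assms opposite_side_ratio[of f j i m t] opposite_side_ratio[of f i j m t]
    by (simp add: right_diff_distrib exp_diff)
  ultimately show ?thesis
    using center_projective_map_edge[OF nondegenerate_pos nondegenerate_target] assms(1-5) by metis
qed

text \<open>
  Along an edge the maps from both sides have the form \<open>edge_param\<close>, with ratios
  \<open>exp (t (\<lambda>\<^sub>i\<^sub>m - \<lambda>\<^sub>j\<^sub>m))\<close>. They agree when these ratios do, and conversely their agreement at the midpoint
  forces equal ratios. Here \<open>m\<close> and \<open>n\<close> are the corners opposite to the edge.
\<close>

lemma fit_together_iff:
  "fit_together S T \<alpha> \<pi> (center_maps t S T \<alpha> \<pi>) \<longleftrightarrow>
    (\<forall>f i j m g k l n. ((f, i, j), (g, k, l)) \<in> glue S \<longrightarrow> m \<notin> {i, j} \<longrightarrow> n \<notin> {k, l} \<longrightarrow>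
       t * (log_scale f i m - log_scale f j m) = t * (log_scale g k n - log_scale g l n))"
    (is "?fit \<longleftrightarrow> ?ratios")
proof
  assume ?fit
  show ?ratios
  proof (intro allI impI)
    fix f i j m g k l n
    assume gl: "((f, i, j), (g, k, l)) \<in> glue S" and mn: "m \<notin> {i, j}" "n \<notin> {k, l}"
    have opp: "j \<noteq> m" "m \<noteq> i" "l \<noteq> n" "n \<noteq> k" using mn by auto
    let ?\<rho> = "exp (t * (log_scale f i m - log_scale f j m))"
    let ?\<rho>' = "exp (t * (log_scale g k n - log_scale g l n))"
    note D = glueD[OF gl]
    define x where "x = (1 - 1/2) *\<^sub>R pos S f i + (1/2 :: real) *\<^sub>R pos S f j"
    define y where "y = (1 - 1/2) *\<^sub>R pos S g k + (1/2 :: real) *\<^sub>R pos S g l"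
    have "identified S (f, i, j) (g, k, l) x y"
      unfolding identified_def x_def y_def by (auto intro!: bexI[of _ "1/2"])
    hence "identified T (side_map \<alpha> \<pi> (f, i, j)) (side_map \<alpha> \<pi> (g, k, l))
        (center_maps t S T \<alpha> \<pi> f x) (center_maps t S T \<alpha> \<pi> g y)"
      using \<open>?fit\<close> gl unfolding fit_together_def by fastforce
    then obtain s where
      "center_maps t S T \<alpha> \<pi> f x = (1 - s) *\<^sub>R target f i + s *\<^sub>R target f j"
      "center_maps t S T \<alpha> \<pi> g y = (1 - s) *\<^sub>R target g k + s *\<^sub>R target g l"
      by (auto simp: identified_def side_map_def target_def)
    moreover have "center_maps t S T \<alpha> \<pi> f x =
        (1 - edge_param ?\<rho> (1/2)) *\<^sub>R target f i + edge_param ?\<rho> (1/2) *\<^sub>R target f j"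
      "center_maps t S T \<alpha> \<pi> g y =
        (1 - edge_param ?\<rho>' (1/2)) *\<^sub>R target g k + edge_param ?\<rho>' (1/2) *\<^sub>R target g l"
      unfolding x_def y_def
      by (rule center_maps_edge[OF D(1,3) opp(1,2)] center_maps_edge[OF D(2,4) opp(3,4)], simp)+
    moreover have "u = v"
      if "(1 - u) *\<^sub>R a + u *\<^sub>R b = (1 - v) *\<^sub>R a + v *\<^sub>R b" "a \<noteq> b" for u v :: real and a b :: "real^2"
    proof -
      have "(u - v) *\<^sub>R (b - a) = 0" using that(1) by (simp add: algebra_simps)
      thus ?thesis using that(2) by simp
    qed
    moreover have "target f i \<noteq> target f j" "target g k \<noteq> target g l"
      using nondegenerate_target D by (auto simp: nondegenerate_def inj_eq)
    ultimately have "edge_param ?\<rho> (1/2) = edge_param ?\<rho>' (1/2)" by metis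
    hence "?\<rho> = ?\<rho>'" by (rule edge_param_half_inj[rotated 2]) auto
    thus "t * (log_scale f i m - log_scale f j m) = t * (log_scale g k n - log_scale g l n)"
      by simp
  qed
next
  assume ?ratios
  have "identified T (side_map \<alpha> \<pi> (f, i, j)) (side_map \<alpha> \<pi> (g, k, l))
      (center_maps t S T \<alpha> \<pi> f x) (center_maps t S T \<alpha> \<pi> g y)"
    if gl: "((f, i, j), (g, k, l)) \<in> glue S" and id: "identified S (f, i, j) (g, k, l) x y"
    for f i j g k l x y
  proof -
    note D = glueD[OF gl]
    obtain m where m: "m \<noteq> i" "m \<noteq> j" using third_corner[OF D(3)] by blast
    obtain n where n: "n \<noteq> k" "n \<noteq> l" using third_corner[OF D(4)] by blast
    define \<rho> where "\<rho> = exp (t * (log_scale f i m - log_scale f j m))"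
    have \<rho>: "\<rho> = exp (t * (log_scale g k n - log_scale g l n))"
      using \<open>?ratios\<close> gl m n unfolding \<rho>_def by (metis insertE singletonD)
    obtain s where s: "s \<in> {0..1}" "x = (1 - s) *\<^sub>R pos S f i + s *\<^sub>R pos S f j"
      "y = (1 - s) *\<^sub>R pos S g k + s *\<^sub>R pos S g l"
      using id by (auto simp: identified_def)
    have "center_maps t S T \<alpha> \<pi> f x =
        (1 - edge_param \<rho> s) *\<^sub>R target f i + edge_param \<rho> s *\<^sub>R target f j"
      unfolding \<rho>_def s(2) using D m s(1) by (intro center_maps_edge) auto
    moreover have "center_maps t S T \<alpha> \<pi> g y =
        (1 - edge_param \<rho> s) *\<^sub>R target g k + edge_param \<rho> s *\<^sub>R target g l"
      unfolding \<rho> s(3) using D n s(1) by (intro center_maps_edge) auto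
    moreover have "edge_param \<rho> s \<in> {0..1}"
      using s(1) by (intro edge_param_in_unit) (auto simp: \<rho>_def)
    ultimately show ?thesis
      unfolding identified_def side_map_def target_def by auto
  qed
  thus ?fit unfolding fit_together_def by auto
qed

text \<open>
  Taking logarithms turns the conformal equations into linear equations for the scale factors.
\<close>

lemma discretely_conformally_equivalent_iff:
  "discretely_conformally_equivalent S T \<alpha> \<pi> \<longleftrightarrow>
    (\<exists>u. \<forall>f\<in>faces S. \<forall>i j. i \<noteq> j \<longrightarrow>
       2 * log_scale f i j = u (vertex S (f, i)) + u (vertex S (f, j)))"
proof -
  have "len T (side_map \<alpha> \<pi> (f, i, j)) = exp (v / 2) * len S (f, i, j) \<longleftrightarrow>
      2 * log_scale f i j = v" if "f \<in> faces S" "i \<noteq> j" for f i j v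
  proof -
    define a where "a = len T (side_map \<alpha> \<pi> (f, i, j))"
    define b where "b = len S (f, i, j)"
    have "a > 0" "b > 0" using len_pos[OF that] by (simp_all add: a_def b_def)
    hence "a = exp (v / 2) * b \<longleftrightarrow> a / b = exp (v / 2)" by (simp add: field_simps)
    also have "\<dots> \<longleftrightarrow> ln (a / b) = v / 2"
      using \<open>a > 0\<close> \<open>b > 0\<close> by (metis divide_pos_pos exp_ln ln_exp)
    finally show ?thesis by (auto simp: log_scale_def a_def b_def)
  qed
  thus ?thesis
    using equiv by (fastforce simp: discretely_conformally_equivalent_def sides_def)
qed

section \<open>Conformal equivalence and fitting maps\<close>

lemma conformal_imp_fit_together:
  assumes "discretely_conformally_equivalent S T \<alpha> \<pi>"
  shows "fit_together S T \<alpha> \<pi> (center_maps t S T \<alpha> \<pi>)"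
proof -
  obtain u where u: "\<And>f i j. f \<in> faces S \<Longrightarrow> i \<noteq> j \<Longrightarrow>
      2 * log_scale f i j = u (vertex S (f, i)) + u (vertex S (f, j))"
    using assms by (auto simp: discretely_conformally_equivalent_iff)
  have "log_scale f i m - log_scale f j m = log_scale g k n - log_scale g l n"
    if gl: "((f, i, j), (g, k, l)) \<in> glue S" and mn: "m \<notin> {i, j}" "n \<notin> {k, l}"
    for f i j m g k l n
  proof -
    note D = glueD[OF gl]
    have "2 * (log_scale f i m - log_scale f j m) = 2 * (log_scale g k n - log_scale g l n)"
      using u[of f i m] u[of f j m] u[of g k n] u[of g l n] D mn glueD(6)[OF D(5)] by auto
    thus ?thesis by simp
  qed
  thus ?thesis unfolding fit_together_iff by metis
qed

text \<open>
  The solution at corner \<open>i\<close> of the equations \<open>2 \<lambda>\<^sub>i\<^sub>j = u\<^sub>i + u\<^sub>j\<close> in one triangle.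
\<close>

definition corner_scale :: "'f \<times> 3 \<Rightarrow> real" where
  "corner_scale = (\<lambda>(f, i). log_scale f i (i + 1) + log_scale f i (i + 2) - log_scale f (i + 1) (i + 2))"

lemma corner_scale_eq:
  assumes "i \<noteq> j" "j \<noteq> m" "m \<noteq> i"
  shows "corner_scale (f, i) = log_scale f i j + log_scale f i m - log_scale f j m"
  using cyclic_corners[OF assms] by (auto simp: corner_scale_def log_scale_commute)

text \<open>
  The fitting condition makes \<open>corner_scale\<close> invariant under gluing of corners, hence constant on each
  vertex; its values are the scale factors.
\<close>

lemma fit_together_imp_conformal:
  assumes "t \<noteq> 0" "fit_together S T \<alpha> \<pi> (center_maps t S T \<alpha> \<pi>)"
  shows "discretely_conformally_equivalent S T \<alpha> \<pi>"
proof -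
  have glue: "corner_scale c = corner_scale d" if "(c, d) \<in> corner_glue S" for c d
  proof -
    obtain f i j g k l where cd: "c = (f, i)" "d = (g, k)"
      and gl: "((f, i, j), (g, k, l)) \<in> glue S"
      using \<open>(c, d) \<in> corner_glue S\<close> by (auto simp: corner_glue_def)
    note D = glueD[OF gl]
    obtain m where m: "m \<noteq> i" "m \<noteq> j" using third_corner[OF D(3)] by blast
    obtain n where n: "n \<noteq> k" "n \<noteq> l" using third_corner[OF D(4)] by blast
    have "t * (log_scale f i m - log_scale f j m) = t * (log_scale g k n - log_scale g l n)"
      using assms(2) gl m n unfolding fit_together_iff by (metis insertE singletonD)
    thus ?thesis
      using D(3,4) m n assms(1) log_scale_glue[OF gl] corner_scale_eq[of i j m f]
        corner_scale_eq[of k l n g] by (simp add: cd)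
  qed
  have const: "corner_scale d = corner_scale c" if "d \<in> vertex S c" for c d
  proof -
    have "(c, d) \<in> (corner_glue S)\<^sup>*" using that by (simp add: vertex_def)
    thus ?thesis by induction (auto dest: glue)
  qed
  define u where "u V = corner_scale (SOME c. c \<in> V)" for V
  have u: "u (vertex S c) = corner_scale c" for c
  proof -
    have "c \<in> vertex S c" by (simp add: vertex_def)
    hence "(SOME d. d \<in> vertex S c) \<in> vertex S c" by (rule someI)
    thus ?thesis unfolding u_def by (rule const)
  qed
  have "2 * log_scale f i j = u (vertex S (f, i)) + u (vertex S (f, j))" if ij: "i \<noteq> j" for f i j
  proof -
    obtain m where "m \<noteq> i" "m \<noteq> j" using third_corner[OF ij] by blast
    thus ?thesis
      using ij corner_scale_eq[of i j m f] corner_scale_eq[of j i m f] log_scale_commute[of f i j]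
      by (simp add: u)
  qed
  thus ?thesis unfolding discretely_conformally_equivalent_iff by blast
qed

end

theorem theorem6p3:
  fixes t :: real
    and S :: "'f glued_triangles" and T :: "'g glued_triangles"
    and \<alpha> :: "'f \<Rightarrow> 'g" and \<pi> :: "'f \<Rightarrow> 3 \<Rightarrow> 3"
  assumes "triangulated_surface S" and "triangulated_surface T"
    and "combinatorial_equivalence S T \<alpha> \<pi>"
  shows "(discretely_conformally_equivalent S T \<alpha> \<pi> \<longrightarrow>
            fit_together S T \<alpha> \<pi> (center_maps t S T \<alpha> \<pi>)) \<and>
         (t \<noteq> 0 \<longrightarrow> fit_together S T \<alpha> \<pi> (center_maps t S T \<alpha> \<pi>) \<longrightarrow>
            discretely_conformally_equivalent S T \<alpha> \<pi>)"
proof -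
  interpret surface_pair S T \<alpha> \<pi>
    using assms by unfold_locales
  show ?thesis
    using conformal_imp_fit_together fit_together_imp_conformal by blast
qed

end
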